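(* Let $\alpha,\beta:X\to Y$ be two coarse maps between metric spaces. Then $Y(\alpha,\beta)$, together with the map $q=\mathrm{id}_Y:Y\to Y(\alpha,\beta)$, is a coequalizer of $\alpha,\beta$ in the category of metric spaces and coarse maps modulo closeness. (Here $Y(\alpha,\beta)$ is regarded as a metric space via a metric whose associated coarse structure is the coarse structure of $Y(\alpha,\beta)$; in particular such a metric exists.)
   Context: Metrics take only finite values. The coarse structure associated to a metric $d$ on $X$ is the collection of all $E\subseteq X\times X$ with $\sup_{(x,y)\in E}d(x,y)<\infty$; its elements are called entourages. In general a coarse structure on a set $X$ is a collection of subsets of $X\times X$ (entourages) that contains the diagonal and is closed under subsets, finite unions, inverses $E^{-1}=\{(y,x):(x,y)\in E\}$ and compositions $E\circ F=\{(x,z):\exists y,\ (x,y)\in E,(y,z)\in F\}$. Intersections of coarse structures are coarse structures, so any collection of subsets of $X\times X$ generates a coarse structure. A map $f:X\to Y$ is coarse if $(f\times f)(E)$ is an entourage for every entourage $E\subseteq X\times X$ and $f^{-1}(B)$ is bounded for every bounded $B\subseteq Y$. Maps $f,g:X\to Y$ are close if $\{(f(x),g(x)):x\in X\}$ is an entourage. For coarse maps $\alpha,\beta:X\to Y$ between metric spaces, $Y(\alpha,\beta)$ is the set $Y$ equipped with the coarse structure generated by the sets $\Delta_R=\{(y,y')\in Y\times Y: d(y,y')\le R\}$, $R\ge0$, and the set $\Delta(\alpha,\beta)=\{(\alpha(x),\beta(x)): x\in X\}$. *)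

theory Defs
  imports "HOL-Analysis.Abstract_Metric_Spaces"
begin

section \<open>Coarse structures\<close>

definition coarse_structure :: "'a set \<Rightarrow> ('a \<times> 'a) set set \<Rightarrow> bool" where
  "coarse_structure M \<E> \<longleftrightarrow>
     \<E> \<subseteq> Pow (M \<times> M) \<and>
     Id_on M \<in> \<E> \<and>
     (\<forall>E\<in>\<E>. \<forall>F. F \<subseteq> E \<longrightarrow> F \<in> \<E>) \<and>
     (\<forall>E\<in>\<E>. \<forall>F\<in>\<E>. E \<union> F \<in> \<E>) \<and>
     (\<forall>E\<in>\<E>. E\<inverse> \<in> \<E>) \<and>
     (\<forall>E\<in>\<E>. \<forall>F\<in>\<E>. E O F \<in> \<E>)"

definition generated_coarse_structure :: "'a set \<Rightarrow> ('a \<times> 'a) set set \<Rightarrow> ('a \<times> 'a) set set" where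
  "generated_coarse_structure M \<G> = \<Inter>{\<E>. coarse_structure M \<E> \<and> \<G> \<subseteq> \<E>}"

lemma coarse_structure_Pow: "coarse_structure M (Pow (M \<times> M))"
  unfolding coarse_structure_def by blast

lemma coarse_structure_generated:
  assumes "\<G> \<subseteq> Pow (M \<times> M)"
  shows "coarse_structure M (generated_coarse_structure M \<G>)"
proof -
  let ?\<C> = "{\<E>. coarse_structure M \<E> \<and> \<G> \<subseteq> \<E>}"
  have "\<Inter>?\<C> \<subseteq> Pow (M \<times> M)"
    by (rule Inter_lower) (simp add: coarse_structure_Pow assms)
  moreover have "Id_on M \<in> \<Inter>?\<C>"
    by (simp add: coarse_structure_def)
  moreover have "\<forall>E\<in>\<Inter>?\<C>. \<forall>F. F \<subseteq> E \<longrightarrow> F \<in> \<Inter>?\<C>"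
  proof (intro ballI allI impI InterI)
    fix E F \<E> assume E: "E \<in> \<Inter>?\<C>" and F: "F \<subseteq> E" and \<E>: "\<E> \<in> ?\<C>"
    from E \<E> have "E \<in> \<E>" by (rule InterD)
    with F \<E> show "F \<in> \<E>" by (simp add: coarse_structure_def)
  qed
  moreover have "\<forall>E\<in>\<Inter>?\<C>. \<forall>F\<in>\<Inter>?\<C>. E \<union> F \<in> \<Inter>?\<C>"
    by (simp add: coarse_structure_def)
  moreover have "\<forall>E\<in>\<Inter>?\<C>. E\<inverse> \<in> \<Inter>?\<C>"
    by (simp add: coarse_structure_def)
  moreover have "\<forall>E\<in>\<Inter>?\<C>. \<forall>F\<in>\<Inter>?\<C>. E O F \<in> \<Inter>?\<C>"
    by (simp add: coarse_structure_def)
  ultimately show ?thesis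
    unfolding generated_coarse_structure_def coarse_structure_def[of M "\<Inter>?\<C>"]
    by (intro conjI)
qed

definition entourages :: "'a metric \<Rightarrow> ('a \<times> 'a) set set" where
  "entourages X = {E. E \<subseteq> mspace X \<times> mspace X \<and> (\<exists>R. \<forall>(x, y)\<in>E. mdist X x y \<le> R)}"


section \<open>Coarse maps and closeness\<close>

definition coarse_map :: "'a metric \<Rightarrow> 'b metric \<Rightarrow> ('a \<Rightarrow> 'b) \<Rightarrow> bool" where
  "coarse_map X Y f \<longleftrightarrow>
     f \<in> mspace X \<rightarrow> mspace Y \<and>
     (\<forall>E\<in>entourages X. map_prod f f ` E \<in> entourages Y) \<and>
     (\<forall>B. Metric_space.mbounded (mspace Y) (mdist Y) B \<longrightarrow>
        Metric_space.mbounded (mspace X) (mdist X) (f -` B \<inter> mspace X))"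

definition close_maps :: "'a metric \<Rightarrow> 'b metric \<Rightarrow> ('a \<Rightarrow> 'b) \<Rightarrow> ('a \<Rightarrow> 'b) \<Rightarrow> bool" where
  "close_maps X Y f g \<longleftrightarrow> (\<lambda>x. (f x, g x)) ` mspace X \<in> entourages Y"


section \<open>The category of metric spaces and coarse maps modulo closeness\<close>

text \<open>Objects are the values of type \<^typ>\<open>'a metric\<close> (for all types \<^typ>\<open>'a\<close>), morphisms are
  closeness classes of coarse maps. Functions agreeing on the carrier of the source are close,
  so their values outside the carrier do not matter.\<close>

definition closeness :: "'a metric \<Rightarrow> 'b metric \<Rightarrow> (('a \<Rightarrow> 'b) \<times> ('a \<Rightarrow> 'b)) set" where
  "closeness X Y = {(f, g). coarse_map X Y f \<and> coarse_map X Y g \<and> close_maps X Y f g}"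

definition coarse_hom :: "'a metric \<Rightarrow> 'b metric \<Rightarrow> ('a \<Rightarrow> 'b) set set" where
  "coarse_hom X Y = Collect (coarse_map X Y) // closeness X Y"

definition coarse_class :: "'a metric \<Rightarrow> 'b metric \<Rightarrow> ('a \<Rightarrow> 'b) \<Rightarrow> ('a \<Rightarrow> 'b) set" where
  "coarse_class X Y f = closeness X Y `` {f}"

definition coarse_comp ::
  "'a metric \<Rightarrow> 'c metric \<Rightarrow> ('b \<Rightarrow> 'c) set \<Rightarrow> ('a \<Rightarrow> 'b) set \<Rightarrow> ('a \<Rightarrow> 'c) set" where
  "coarse_comp X Z G F = (\<Union>g\<in>G. \<Union>f\<in>F. coarse_class X Z (g \<circ> f))"

lemma coarse_map_mspace: "coarse_map X Y f \<Longrightarrow> x \<in> mspace X \<Longrightarrow> f x \<in> mspace Y"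
  unfolding coarse_map_def by blast

lemma closeness_iff:
  "(f, g) \<in> closeness X Y \<longleftrightarrow> coarse_map X Y f \<and> coarse_map X Y g \<and>
     (\<exists>R. \<forall>x\<in>mspace X. mdist Y (f x) (g x) \<le> R)"
  using coarse_map_mspace[of X Y f] coarse_map_mspace[of X Y g]
  by (auto simp: closeness_def close_maps_def entourages_def)

lemma equiv_closeness: "equiv (Collect (coarse_map X Y)) (closeness X Y)"
proof (rule equivI)
  show "closeness X Y \<subseteq> Collect (coarse_map X Y) \<times> Collect (coarse_map X Y)"
    by (auto simp: closeness_iff)
  show "refl_on (Collect (coarse_map X Y)) (closeness X Y)"
  proof (rule refl_onI)
    fix f assume "f \<in> Collect (coarse_map X Y)"
    then have f: "coarse_map X Y f" by simp
    have "mdist Y (f x) (f x) = 0" if "x \<in> mspace X" for x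
      using coarse_map_mspace[OF f that] by simp
    then have "\<forall>x\<in>mspace X. mdist Y (f x) (f x) \<le> 0"
      by simp
    with f show "(f, f) \<in> closeness X Y"
      unfolding closeness_iff by blast
  qed
  show "sym (closeness X Y)"
  proof (rule symI)
    fix f g assume "(f, g) \<in> closeness X Y"
    then show "(g, f) \<in> closeness X Y"
      unfolding closeness_iff mdist_commute[of Y "g _"] by blast
  qed
  show "trans (closeness X Y)"
  proof (rule transI)
    fix f g h assume fg: "(f, g) \<in> closeness X Y" and gh: "(g, h) \<in> closeness X Y"
    have maps: "coarse_map X Y f" "coarse_map X Y g" "coarse_map X Y h"
      using fg gh unfolding closeness_iff by blast+
    from fg obtain R where R: "\<forall>x\<in>mspace X. mdist Y (f x) (g x) \<le> R"
      unfolding closeness_iff by blast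
    from gh obtain S where S: "\<forall>x\<in>mspace X. mdist Y (g x) (h x) \<le> S"
      unfolding closeness_iff by blast
    have "mdist Y (f x) (h x) \<le> R + S" if x: "x \<in> mspace X" for x
    proof -
      have "mdist Y (f x) (h x) \<le> mdist Y (f x) (g x) + mdist Y (g x) (h x)"
        using maps x by (intro mdist_triangle) (simp_all add: coarse_map_mspace)
      also have "\<dots> \<le> R + S"
        using R S x by (intro add_mono) simp_all
      finally show ?thesis .
    qed
    then show "(f, h) \<in> closeness X Y"
      using maps unfolding closeness_iff by blast
  qed
qed

lemma coarse_map_comp:
  assumes "coarse_map X Y f" "coarse_map Y Z g"
  shows "coarse_map X Z (g \<circ> f)"
  unfolding coarse_map_def
proof (intro conjI ballI allI impI)
  show "g \<circ> f \<in> mspace X \<rightarrow> mspace Z"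
    using assms by (auto simp: coarse_map_def)
  show "map_prod (g \<circ> f) (g \<circ> f) ` E \<in> entourages Z" if "E \<in> entourages X" for E
  proof -
    have "map_prod g g ` map_prod f f ` E \<in> entourages Z"
      using assms that by (simp add: coarse_map_def)
    then show ?thesis
      by (simp add: image_comp map_prod_compose)
  qed
  show "Metric_space.mbounded (mspace X) (mdist X) ((g \<circ> f) -` B \<inter> mspace X)"
    if "Metric_space.mbounded (mspace Z) (mdist Z) B" for B
  proof -
    have "Metric_space.mbounded (mspace X) (mdist X) (f -` (g -` B \<inter> mspace Y) \<inter> mspace X)"
      using assms that unfolding coarse_map_def by blast
    moreover have "f -` (g -` B \<inter> mspace Y) \<inter> mspace X = (g \<circ> f) -` B \<inter> mspace X"
      using assms(1) by (auto simp: coarse_map_def)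
    ultimately show ?thesis by simp
  qed
qed

text \<open>Composition of classes is induced by composition of representatives.\<close>

lemma coarse_comp_class:
  assumes f: "coarse_map X Y f" and g: "coarse_map Y Z g"
  shows "coarse_comp X Z (coarse_class Y Z g) (coarse_class X Y f) = coarse_class X Z (g \<circ> f)"
proof -
  have eq: "coarse_class X Z (g' \<circ> f') = coarse_class X Z (g \<circ> f)"
    if g': "g' \<in> coarse_class Y Z g" and f': "f' \<in> coarse_class X Y f" for g' f'
  proof -
    have cm: "coarse_map X Y f'" "coarse_map Y Z g'"
      using f' g' by (auto simp: coarse_class_def closeness_def)
    have "(\<lambda>x. (f x, f' x)) ` mspace X \<in> entourages Y"
      using f' by (simp add: coarse_class_def closeness_def close_maps_def)
    then have "map_prod g g ` (\<lambda>x. (f x, f' x)) ` mspace X \<in> entourages Z"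
      using g unfolding coarse_map_def by blast
    then have "(g \<circ> f, g \<circ> f') \<in> closeness X Z"
      using coarse_map_comp[OF f g] coarse_map_comp[OF cm(1) g]
      by (simp add: closeness_def close_maps_def image_image)
    moreover have "(g \<circ> f', g' \<circ> f') \<in> closeness X Z"
    proof -
      have "(g, g') \<in> closeness Y Z"
        using g' by (simp add: coarse_class_def)
      then obtain R where "\<forall>y\<in>mspace Y. mdist Z (g y) (g' y) \<le> R"
        unfolding closeness_iff by blast
      then have "\<forall>x\<in>mspace X. mdist Z ((g \<circ> f') x) ((g' \<circ> f') x) \<le> R"
        using coarse_map_mspace[OF cm(1)] by simp
      then show ?thesis
        using coarse_map_comp[OF cm(1) g] coarse_map_comp[OF cm]
        unfolding closeness_iff by blast
    qed
    ultimately have "(g \<circ> f, g' \<circ> f') \<in> closeness X Z"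
      using equiv_closeness[of X Z] unfolding equiv_def by (blast dest: transD)
    then show ?thesis
      unfolding coarse_class_def by (rule equiv_class_eq[OF equiv_closeness, symmetric])
  qed
  have "f \<in> coarse_class X Y f" "g \<in> coarse_class Y Z g"
    unfolding coarse_class_def using f g equiv_class_self[OF equiv_closeness] by auto
  then show ?thesis
    unfolding coarse_comp_def using eq by blast
qed

text \<open>The test objects \<open>Z\<close> range over all metric spaces carried by subsets of the type given by
  the first argument. A statement for \<^term>\<open>TYPE('c)\<close> with \<^typ>\<open>'c\<close> a free type variable
  covers test objects of every type.\<close>

definition is_coarse_coequalizer ::
  "'c itself \<Rightarrow> 'a metric \<Rightarrow> 'b metric \<Rightarrow> ('a \<Rightarrow> 'b) set \<Rightarrow> ('a \<Rightarrow> 'b) set \<Rightarrow>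
   'd metric \<Rightarrow> ('b \<Rightarrow> 'd) set \<Rightarrow> bool" where
  "is_coarse_coequalizer (_ :: 'c itself) X Y a b Q q \<longleftrightarrow>
     a \<in> coarse_hom X Y \<and> b \<in> coarse_hom X Y \<and> q \<in> coarse_hom Y Q \<and>
     coarse_comp X Q q a = coarse_comp X Q q b \<and>
     (\<forall>Z :: 'c metric. \<forall>f\<in>coarse_hom Y Z.
        coarse_comp X Z f a = coarse_comp X Z f b \<longrightarrow>
        (\<exists>!h. h \<in> coarse_hom Q Z \<and> coarse_comp Y Z h q = f))"


section \<open>The coarse structure of the coequalizer\<close>

definition coeq_coarse_structure ::
  "'a metric \<Rightarrow> 'b metric \<Rightarrow> ('a \<Rightarrow> 'b) \<Rightarrow> ('a \<Rightarrow> 'b) \<Rightarrow> ('b \<times> 'b) set set" where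
  "coeq_coarse_structure X Y \<alpha> \<beta> = generated_coarse_structure (mspace Y)
     ({{(y, y'). y \<in> mspace Y \<and> y' \<in> mspace Y \<and> mdist Y y y' \<le> R} | R. R \<ge> 0} \<union>
      {(\<lambda>x. (\<alpha> x, \<beta> x)) ` mspace X})"

end

theory Submission
  imports Defs
begin

text \<open>The universal property is a matter of testing generators. Whenever the subsets
  \<open>E \<subseteq> Y \<times> Y\<close> with some property form a coarse structure, the property holds for all entourages
  of \<open>Y(\<alpha>, \<beta>)\<close> as soon as it holds for the \<open>\<Delta>\<^sub>R\<close> and for \<open>\<Delta>(\<alpha>, \<beta>)\<close>. This is applied twice.

  \<^item> The sets \<open>E\<close> that, together with their inverses, thicken bounded subsets of \<open>Y\<close> to bounded
    subsets of \<open>Y\<close> form a coarse structure. It contains \<open>\<Delta>(\<alpha>, \<beta>)\<close>: if \<open>B\<close> is bounded, then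
    \<open>\<alpha>\<inverse>(B)\<close> is bounded, and so is its image under \<open>\<beta>\<close>. Therefore gluing \<open>\<alpha>(x)\<close> to \<open>\<beta>(x)\<close>
    creates no new bounded sets, and the identity \<open>Y \<rightarrow> Y(\<alpha>, \<beta>)\<close> is a coarse map
    (\<open>coarse_map_id_coeq\<close>).

  \<^item> If \<open>f : Y \<rightarrow> Z\<close> is coarse and \<open>f \<circ> \<alpha>\<close> is close to \<open>f \<circ> \<beta>\<close>, the sets \<open>E\<close> that \<open>f\<close> maps to
    entourages of \<open>Z\<close> form a coarse structure containing all generators, so \<open>f\<close> itself is a
    coarse map on \<open>Y(\<alpha>, \<beta>)\<close> (\<open>coarse_map_from_coeq\<close>). This gives the factorization, and
    it is unique because \<open>Y\<close> and \<open>Y(\<alpha>, \<beta>)\<close> have the same points.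

  The metric exists because the coarse structure is generated by the countably many sets
  \<open>\<Delta>(\<alpha>, \<beta>)\<close>, \<open>\<Delta>\<^sub>0, \<Delta>\<^sub>1, \<Delta>\<^sub>2, \<dots>\<close>, which cover \<open>Y \<times> Y\<close>. Give a step along the \<open>k\<close>-th generator,
  in either direction, the cost \<open>k + 1\<close> and let the distance of two points be the least cost of a chain joining them. A
  chain of bounded cost uses boundedly many steps, each along one of finitely many generators, so
  the bounded sets of pairs are precisely the members of the generated coarse structure
  (\<open>countably_generated_metrizable\<close>).\<close>


section \<open>Generated coarse structures\<close>

lemma generated_coarse_structure_least:
  assumes "coarse_structure M \<E>" "\<G> \<subseteq> \<E>"
  shows "generated_coarse_structure M \<G> \<subseteq> \<E>"
  using assms unfolding generated_coarse_structure_def by blast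

lemma generator_in_generated_coarse_structure:
  "G \<in> \<G> \<Longrightarrow> G \<in> generated_coarse_structure M \<G>"
  unfolding generated_coarse_structure_def by blast

lemma coarse_structure_Id_on: "coarse_structure M \<E> \<Longrightarrow> Id_on M \<in> \<E>"
  by (simp add: coarse_structure_def)

lemma coarse_structure_subset: "coarse_structure M \<E> \<Longrightarrow> E \<in> \<E> \<Longrightarrow> F \<subseteq> E \<Longrightarrow> F \<in> \<E>"
  unfolding coarse_structure_def by meson

lemma coarse_structure_Un: "coarse_structure M \<E> \<Longrightarrow> E \<in> \<E> \<Longrightarrow> F \<in> \<E> \<Longrightarrow> E \<union> F \<in> \<E>"
  by (simp add: coarse_structure_def)

lemma coarse_structure_converse: "coarse_structure M \<E> \<Longrightarrow> E \<in> \<E> \<Longrightarrow> E\<inverse> \<in> \<E>"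
  by (simp add: coarse_structure_def)

lemma coarse_structure_relcomp:
  "coarse_structure M \<E> \<Longrightarrow> E \<in> \<E> \<Longrightarrow> F \<in> \<E> \<Longrightarrow> E O F \<in> \<E>"
  by (simp add: coarse_structure_def)

lemma coarse_structure_Times: "coarse_structure M \<E> \<Longrightarrow> E \<in> \<E> \<Longrightarrow> E \<subseteq> M \<times> M"
  by (auto simp: coarse_structure_def)

lemma coarse_structure_UN:
  assumes cs: "coarse_structure M \<E>" and "finite I" and "\<And>i. i \<in> I \<Longrightarrow> E i \<in> \<E>"
  shows "(\<Union>i\<in>I. E i) \<in> \<E>"
  using assms(2,3)
proof (induction I rule: finite_induct)
  case empty
  show ?case
    using coarse_structure_subset[OF cs coarse_structure_Id_on[OF cs]] by simp
next
  case (insert i I)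
  then show ?case
    using coarse_structure_Un[OF cs] by simp
qed


section \<open>The bounded coarse structure of a metric\<close>

lemma coarse_structure_entourages: "coarse_structure (mspace X) (entourages X)"
  unfolding coarse_structure_def
proof (intro conjI ballI allI impI)
  show "entourages X \<subseteq> Pow (mspace X \<times> mspace X)"
    by (auto simp: entourages_def)
  have "\<forall>(x, y)\<in>Id_on (mspace X). mdist X x y \<le> 0"
  proof clarify
    fix x assume "x \<in> mspace X"
    then have "mdist X x x = 0" by simp
    then show "mdist X x x \<le> 0" by simp
  qed
  then show "Id_on (mspace X) \<in> entourages X"
    unfolding entourages_def by blast
  show "F \<in> entourages X" if "E \<in> entourages X" "F \<subseteq> E" for E F
    using that unfolding entourages_def by blast
  show "E\<inverse> \<in> entourages X" if "E \<in> entourages X" for E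
  proof -
    from that obtain R where "E \<subseteq> mspace X \<times> mspace X" "\<forall>(x, y)\<in>E. mdist X x y \<le> R"
      unfolding entourages_def by blast
    then have "E\<inverse> \<subseteq> mspace X \<times> mspace X" "\<forall>(x, y)\<in>E\<inverse>. mdist X x y \<le> R"
      by (auto simp: mdist_commute[of X])
    then show ?thesis unfolding entourages_def by blast
  qed
  fix E F assume "E \<in> entourages X" and "F \<in> entourages X"
  then obtain R S where
    E: "E \<subseteq> mspace X \<times> mspace X" "\<And>x y. (x, y) \<in> E \<Longrightarrow> mdist X x y \<le> R" and
    F: "F \<subseteq> mspace X \<times> mspace X" "\<And>x y. (x, y) \<in> F \<Longrightarrow> mdist X x y \<le> S"
    unfolding entourages_def by blast
  have "\<forall>(x, y)\<in>E \<union> F. mdist X x y \<le> max R S"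
    using E(2) F(2) by (fastforce simp: le_max_iff_disj)
  with E(1) F(1) show "E \<union> F \<in> entourages X"
    unfolding entourages_def by blast
  have "mdist X x z \<le> R + S" if "(x, y) \<in> E" "(y, z) \<in> F" for x y z
  proof -
    have "mdist X x z \<le> mdist X x y + mdist X y z"
      using that E(1) F(1) by (intro mdist_triangle) auto
    with E(2)[OF that(1)] F(2)[OF that(2)] show ?thesis by linarith
  qed
  then have "\<forall>(x, z)\<in>E O F. mdist X x z \<le> R + S"
    by blast
  moreover have "E O F \<subseteq> mspace X \<times> mspace X"
    using E(1) F(1) by blast
  ultimately show "E O F \<in> entourages X"
    unfolding entourages_def by blast
qed

abbreviation bounded_in :: "'a metric \<Rightarrow> 'a set \<Rightarrow> bool" where
  "bounded_in X \<equiv> Metric_space.mbounded (mspace X) (mdist X)"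

text \<open>Boundedness depends on the coarse structure only, so it may be compared between metrics
  through their entourages.\<close>

lemma bounded_in_iff_entourage: "bounded_in X B \<longleftrightarrow> B \<times> B \<in> entourages X"
  unfolding Metric_space.mbounded_alt[OF Metric_space_mspace_mdist] entourages_def by blast

lemma bounded_in_image:
  assumes "coarse_map X Y f" "bounded_in X B"
  shows "bounded_in Y (f ` B)"
proof -
  have "map_prod f f ` (B \<times> B) \<in> entourages Y"
    using assms unfolding coarse_map_def bounded_in_iff_entourage by blast
  then show ?thesis
    by (simp add: bounded_in_iff_entourage map_prod_surj_on)
qed


section \<open>Metrizability of countably generated coarse structures\<close>

inductive chain :: "'a set \<Rightarrow> (nat \<Rightarrow> 'a rel) \<Rightarrow> nat \<Rightarrow> 'a \<Rightarrow> 'a \<Rightarrow> bool"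
  for M :: "'a set" and G :: "nat \<Rightarrow> 'a rel" where
  chain_refl: "x \<in> M \<Longrightarrow> chain M G 0 x x"
| chain_step: "chain M G n x y \<Longrightarrow> (y, z) \<in> G k \<union> (G k)\<inverse> \<Longrightarrow> chain M G (n + Suc k) x z"

definition chain_dist :: "'a set \<Rightarrow> (nat \<Rightarrow> 'a rel) \<Rightarrow> 'a \<Rightarrow> 'a \<Rightarrow> real" where
  "chain_dist M G x y = real (LEAST n. chain M G n x y)"

lemma chain_zero_iff: "chain M G 0 x y \<longleftrightarrow> x \<in> M \<and> x = y"
  by (auto elim: chain.cases intro: chain_refl)

lemma chain_trans:
  assumes "chain M G n y z" "chain M G m x y"
  shows "chain M G (m + n) x z"
  using assms
proof induction
  case (chain_step n y u z k)
  then show ?case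
    using chain.chain_step[of M G "m + n" x u z k] by (simp add: add.assoc)
qed simp

lemma chain_single:
  assumes "(x, y) \<in> G k \<union> (G k)\<inverse>" "x \<in> M"
  shows "chain M G (Suc k) x y"
  using chain_step[of M G 0 x x y k] chain_refl[of x M G] assms by simp

lemma chain_sym:
  assumes "\<And>k. G k \<subseteq> M \<times> M" "chain M G n x y"
  shows "chain M G n y x"
  using assms(2)
proof induction
  case (chain_refl x)
  then show ?case by (rule chain.chain_refl)
next
  case (chain_step n x y z k)
  have "(z, y) \<in> G k \<union> (G k)\<inverse>" "z \<in> M"
    using chain_step assms(1) by blast+
  then have "chain M G (Suc k) z y"
    by (rule chain_single)
  from chain_trans[OF chain_step.IH this] show ?case
    by (simp add: add.commute)
qed

lemma chain_dist_le: "chain M G n x y \<Longrightarrow> chain_dist M G x y \<le> real n"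
  unfolding chain_dist_def by (simp add: Least_le)

text \<open>Splitting off the last step of a chain shows that the chains of a fixed cost are covered by
  finitely many compositions of generators. The cost of the remaining chain is strictly smaller
  since every step has positive cost.\<close>

lemma chain_in_generated:
  assumes G: "\<And>k. G k \<subseteq> M \<times> M"
  shows "{(x, y). chain M G n x y} \<in> generated_coarse_structure M (range G)"
proof (induction n rule: less_induct)
  case (less n)
  let ?\<E> = "generated_coarse_structure M (range G)"
  let ?C = "\<lambda>n. {(x, y). chain M G n x y}"
  have cs: "coarse_structure M ?\<E>"
    by (rule coarse_structure_generated) (use G in auto)
  have gen: "G k \<union> (G k)\<inverse> \<in> ?\<E>" for k
    by (intro coarse_structure_Un[OF cs] coarse_structure_converse[OF cs]
        generator_in_generated_coarse_structure) auto
  have "Id_on M \<union> (\<Union>k\<in>{..<n}. ?C (n - Suc k) O (G k \<union> (G k)\<inverse>)) \<in> ?\<E>"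
    by (intro coarse_structure_Un[OF cs] coarse_structure_Id_on[OF cs] coarse_structure_UN[OF cs]
        coarse_structure_relcomp[OF cs] gen less.IH) auto
  moreover have "?C n \<subseteq> Id_on M \<union> (\<Union>k\<in>{..<n}. ?C (n - Suc k) O (G k \<union> (G k)\<inverse>))"
  proof (clarify, goal_cases)
    case (1 x z)
    from \<open>chain M G n x z\<close> show ?case
    proof cases
      case chain_refl
      then show ?thesis by (simp add: Id_on_iff)
    next
      case (chain_step m y k)
      then have "k \<in> {..<n}" "(x, z) \<in> ?C (n - Suc k) O (G k \<union> (G k)\<inverse>)"
        by auto
      with 1 show ?thesis by blast
    qed
  qed
  ultimately show ?case
    by (rule coarse_structure_subset[OF cs])
qed

text \<open>Covering \<open>M \<times> M\<close> by the generators makes the distance finite, since it joins any two points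
  by a chain. Distinct points have distance at least 1.\<close>

theorem countably_generated_metrizable:
  fixes G :: "nat \<Rightarrow> 'a rel"
  assumes G: "\<And>k. G k \<subseteq> M \<times> M" and cover: "M \<times> M \<subseteq> (\<Union>k. G k)"
  shows "\<exists>Q. mspace Q = M \<and> entourages Q = generated_coarse_structure M (range G)"
proof -
  let ?d = "chain_dist M G"
  have ex: "\<exists>n. chain M G n x y" if "x \<in> M" "y \<in> M" for x y
    using that cover chain_single[of x y G _ M] by blast
  have least: "\<exists>n. chain M G n x y \<and> ?d x y = real n" if "x \<in> M" "y \<in> M" for x y
    using LeastI_ex[OF ex[OF that]] unfolding chain_dist_def by blast
  interpret Metric_space M ?d
  proof
    show "0 \<le> ?d x y" for x y
      by (simp add: chain_dist_def)
    show "?d x y = ?d y x" for x y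
    proof -
      have "chain M G n x y \<longleftrightarrow> chain M G n y x" for n
        using chain_sym[of G M, OF G] by blast
      then show ?thesis by (simp add: chain_dist_def)
    qed
    show "?d x y = 0 \<longleftrightarrow> x = y" if xy: "x \<in> M" "y \<in> M" for x y
    proof
      assume "?d x y = 0"
      with least[OF xy] have "chain M G 0 x y" by auto
      then show "x = y" by (simp add: chain_zero_iff)
    next
      assume "x = y"
      with xy have "chain M G 0 x y" by (simp add: chain_zero_iff)
      from chain_dist_le[OF this] show "?d x y = 0" by (simp add: chain_dist_def)
    qed
    show "?d x z \<le> ?d x y + ?d y z" if "x \<in> M" "y \<in> M" "z \<in> M" for x y z
    proof -
      obtain m where m: "chain M G m x y" "?d x y = real m"
        using least[of x y] \<open>x \<in> M\<close> \<open>y \<in> M\<close> by blast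
      obtain n where n: "chain M G n y z" "?d y z = real n"
        using least[of y z] \<open>y \<in> M\<close> \<open>z \<in> M\<close> by blast
      show ?thesis
        using chain_dist_le[OF chain_trans[OF n(1) m(1)]] m(2) n(2) by simp
    qed
  qed
  let ?Q = "metric (M, ?d)"
  let ?\<E> = "generated_coarse_structure M (range G)"
  have cs: "coarse_structure M ?\<E>"
    by (rule coarse_structure_generated) (use G in auto)
  have "entourages ?Q = ?\<E>"
  proof
    show "entourages ?Q \<subseteq> ?\<E>"
    proof
      fix E assume "E \<in> entourages ?Q"
      then obtain R where E: "E \<subseteq> M \<times> M" "\<forall>(x, y)\<in>E. ?d x y \<le> R"
        by (auto simp: entourages_def)
      obtain N where N: "R \<le> real N"
        using real_arch_simple by blast
      have "(\<Union>n\<in>{..N}. {(x, y). chain M G n x y}) \<in> ?\<E>"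
        by (intro coarse_structure_UN[OF cs] chain_in_generated[OF G]) auto
      moreover have "E \<subseteq> (\<Union>n\<in>{..N}. {(x, y). chain M G n x y})"
      proof clarify
        fix x y assume xy: "(x, y) \<in> E"
        then obtain n where "chain M G n x y" "?d x y = real n"
          using least E(1) by blast
        moreover have "?d x y \<le> R" using E(2) xy by blast
        ultimately show "(x, y) \<in> (\<Union>n\<in>{..N}. {(x, y). chain M G n x y})"
          using N by auto
      qed
      ultimately show "E \<in> ?\<E>"
        by (rule coarse_structure_subset[OF cs])
    qed
    show "?\<E> \<subseteq> entourages ?Q"
    proof (rule generated_coarse_structure_least)
      show "coarse_structure M (entourages ?Q)"
        using coarse_structure_entourages[of ?Q] by simp
      have "?d x y \<le> real (Suc k)" if "(x, y) \<in> G k" for x y k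
        using that G by (intro chain_dist_le chain_single) auto
      then show "range G \<subseteq> entourages ?Q"
        using G by (fastforce simp: entourages_def)
    qed
  qed
  then show ?thesis
    by (intro exI[of _ ?Q]) simp
qed


section \<open>The coarse structure of the coequalizer\<close>

text \<open>All \<open>\<Delta>\<^sub>R\<close> may be replaced by arbitrary entourages of \<open>Y\<close>, since each of these lies in some
  \<open>\<Delta>\<^sub>R\<close>; this removes the radii from the arguments below.\<close>

lemma coeq_coarse_structure_least:
  assumes "coarse_structure (mspace Y) \<E>" "entourages Y \<subseteq> \<E>"
    and "(\<lambda>x. (\<alpha> x, \<beta> x)) ` mspace X \<in> \<E>"
  shows "coeq_coarse_structure X Y \<alpha> \<beta> \<subseteq> \<E>"
proof -
  have "{(y, y'). y \<in> mspace Y \<and> y' \<in> mspace Y \<and> mdist Y y y' \<le> R} \<in> entourages Y" for R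
    unfolding entourages_def by auto
  then show ?thesis
    unfolding coeq_coarse_structure_def
    by (intro generated_coarse_structure_least assms(1)) (use assms(2,3) in blast)
qed

lemma graph_in_coeq:
  "(\<lambda>x. (\<alpha> x, \<beta> x)) ` mspace X \<in> coeq_coarse_structure X Y \<alpha> \<beta>"
  unfolding coeq_coarse_structure_def by (rule generator_in_generated_coarse_structure) simp

lemma coarse_structure_coeq:
  assumes "coarse_map X Y \<alpha>" "coarse_map X Y \<beta>"
  shows "coarse_structure (mspace Y) (coeq_coarse_structure X Y \<alpha> \<beta>)"
  unfolding coeq_coarse_structure_def
  by (rule coarse_structure_generated) (use assms coarse_map_mspace in fastforce)

lemma entourages_subset_coeq:
  assumes "coarse_map X Y \<alpha>" "coarse_map X Y \<beta>"
  shows "entourages Y \<subseteq> coeq_coarse_structure X Y \<alpha> \<beta>"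
proof
  fix E assume "E \<in> entourages Y"
  then obtain R where E: "E \<subseteq> mspace Y \<times> mspace Y" "\<forall>(x, y)\<in>E. mdist Y x y \<le> R"
    by (auto simp: entourages_def)
  let ?D = "{(y, y'). y \<in> mspace Y \<and> y' \<in> mspace Y \<and> mdist Y y y' \<le> max 0 R}"
  have "?D \<in> coeq_coarse_structure X Y \<alpha> \<beta>"
    unfolding coeq_coarse_structure_def
    by (rule generator_in_generated_coarse_structure) (use max.cobounded1 in blast)
  moreover have "E \<subseteq> ?D"
    using E by (auto simp: le_max_iff_disj)
  ultimately show "E \<in> coeq_coarse_structure X Y \<alpha> \<beta>"
    using coarse_structure_subset[OF coarse_structure_coeq[OF assms]] by blast
qed

theorem coeq_metrizable:
  assumes "coarse_map X Y \<alpha>" "coarse_map X Y \<beta>"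
  shows "\<exists>Q. mspace Q = mspace Y \<and> entourages Q = coeq_coarse_structure X Y \<alpha> \<beta>"
proof -
  let ?\<E> = "coeq_coarse_structure X Y \<alpha> \<beta>"
  let ?D = "(\<lambda>x. (\<alpha> x, \<beta> x)) ` mspace X"
  define G where "G k = (case k of 0 \<Rightarrow> ?D
      | Suc n \<Rightarrow> {(y, y'). y \<in> mspace Y \<and> y' \<in> mspace Y \<and> mdist Y y y' \<le> real n})" for k
  have G: "G k \<subseteq> mspace Y \<times> mspace Y" for k
    using assms by (auto simp: G_def coarse_map_mspace split: nat.splits)
  have reach: "\<exists>n. \<forall>p\<in>E. p \<in> G (Suc n)" if "E \<in> entourages Y" for E
  proof -
    from that obtain R where E: "E \<subseteq> mspace Y \<times> mspace Y" "\<forall>(x, y)\<in>E. mdist Y x y \<le> R"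
      by (auto simp: entourages_def)
    obtain n where "R \<le> real n"
      using real_arch_simple by blast
    with E show ?thesis
      by (intro exI[of _ n]) (fastforce simp: G_def)
  qed
  have cover: "mspace Y \<times> mspace Y \<subseteq> (\<Union>k. G k)"
  proof clarify
    fix y y' assume "y \<in> mspace Y" "y' \<in> mspace Y"
    then have "{(y, y')} \<in> entourages Y" by (auto simp: entourages_def)
    from reach[OF this] show "(y, y') \<in> (\<Union>k. G k)" by blast
  qed
  have csG: "coarse_structure (mspace Y) (generated_coarse_structure (mspace Y) (range G))"
    by (rule coarse_structure_generated) (use G in auto)
  have "generated_coarse_structure (mspace Y) (range G) = ?\<E>"
  proof
    have "G k \<in> ?\<E>" for k
    proof (cases k)
      case 0
      then show ?thesis by (simp add: G_def graph_in_coeq)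
    next
      case (Suc n)
      then have "G k \<in> entourages Y" by (auto simp: G_def entourages_def)
      then show ?thesis using entourages_subset_coeq[OF assms] by blast
    qed
    then show "generated_coarse_structure (mspace Y) (range G) \<subseteq> ?\<E>"
      by (intro generated_coarse_structure_least coarse_structure_coeq assms) blast
    show "?\<E> \<subseteq> generated_coarse_structure (mspace Y) (range G)"
    proof (rule coeq_coarse_structure_least[OF csG])
      show "entourages Y \<subseteq> generated_coarse_structure (mspace Y) (range G)"
      proof
        fix E assume "E \<in> entourages Y"
        with reach obtain n where "E \<subseteq> G (Suc n)" by blast
        then show "E \<in> generated_coarse_structure (mspace Y) (range G)"
          using coarse_structure_subset[OF csG generator_in_generated_coarse_structure] by blast
      qed
      have "?D = G 0" by (simp add: G_def)
      then show "?D \<in> generated_coarse_structure (mspace Y) (range G)"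
        by (simp add: generator_in_generated_coarse_structure)
    qed
  qed
  with countably_generated_metrizable[OF G cover] show ?thesis by simp
qed


section \<open>Bounded sets of the coequalizer\<close>

text \<open>The inverse has to be controlled as well, because thickening by \<open>E\<close> says nothing about
  thickening by \<open>E\<inverse>\<close>: the graph of a constant self-map, for example, thickens
  everything to a bounded set, while its inverse thickens a single point to the whole space.\<close>

definition thickening_structure :: "'a metric \<Rightarrow> 'a rel set" where
  "thickening_structure Y = {E. E \<subseteq> mspace Y \<times> mspace Y \<and>
     (\<forall>B. bounded_in Y B \<longrightarrow> bounded_in Y (E `` B) \<and> bounded_in Y (E\<inverse> `` B))}"

lemma coarse_structure_thickening: "coarse_structure (mspace Y) (thickening_structure Y)"
proof -
  note Un = Metric_space.mbounded_Un[OF Metric_space_mspace_mdist]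
  note sub = Metric_space.mbounded_subset[OF Metric_space_mspace_mdist]
  show ?thesis
    unfolding coarse_structure_def
  proof (intro conjI ballI allI impI)
    show "thickening_structure Y \<subseteq> Pow (mspace Y \<times> mspace Y)"
      by (auto simp: thickening_structure_def)
    have "Id_on (mspace Y) `` B \<subseteq> B" for B by auto
    then show "Id_on (mspace Y) \<in> thickening_structure Y"
      by (auto simp: thickening_structure_def intro: sub)
    show "F \<in> thickening_structure Y" if "E \<in> thickening_structure Y" "F \<subseteq> E" for E F
    proof -
      have mono: "F `` B \<subseteq> E `` B" "F\<inverse> `` B \<subseteq> E\<inverse> `` B" for B using that(2) by blast+
      have "bounded_in Y (F `` B)" "bounded_in Y (F\<inverse> `` B)" if "bounded_in Y B" for B
        using \<open>E \<in> thickening_structure Y\<close> that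
        by (auto simp: thickening_structure_def intro: sub[OF _ mono(1)] sub[OF _ mono(2)])
      with that show ?thesis
        by (auto simp: thickening_structure_def)
    qed
    show "E \<union> F \<in> thickening_structure Y"
      if "E \<in> thickening_structure Y" "F \<in> thickening_structure Y" for E F
      using that by (auto simp: thickening_structure_def Un_Image converse_Un Un)
    show "E\<inverse> \<in> thickening_structure Y" if "E \<in> thickening_structure Y" for E
      using that by (auto simp: thickening_structure_def)
    show "E O F \<in> thickening_structure Y"
      if "E \<in> thickening_structure Y" "F \<in> thickening_structure Y" for E F
      using that by (auto simp: thickening_structure_def relcomp_Image converse_relcomp)
  qed
qed

lemma entourages_subset_thickening: "entourages Y \<subseteq> thickening_structure Y"
proof
  note cs = coarse_structure_entourages[of Y]
  have thick: "bounded_in Y (E `` B)" if E: "E \<in> entourages Y" and "bounded_in Y B" for E B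
  proof -
    have "E\<inverse> O (B \<times> B) O E \<in> entourages Y"
      using that unfolding bounded_in_iff_entourage
      by (intro coarse_structure_relcomp[OF cs] coarse_structure_converse[OF cs])
    moreover have "E `` B \<times> E `` B \<subseteq> E\<inverse> O (B \<times> B) O E" by blast
    ultimately show ?thesis
      unfolding bounded_in_iff_entourage by (rule coarse_structure_subset[OF cs])
  qed
  fix E assume "E \<in> entourages Y"
  then show "E \<in> thickening_structure Y"
    using thick coarse_structure_converse[OF cs] coarse_structure_Times[OF cs]
    unfolding thickening_structure_def by blast
qed

text \<open>Thickening \<open>B\<close> by \<open>\<Delta>(\<alpha>, \<beta>)\<close> gives \<open>\<beta>(\<alpha>\<inverse>(B))\<close>, and properness of \<open>\<alpha>\<close> makes \<open>\<alpha>\<inverse>(B)\<close>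
  bounded; for the inverse the two maps exchange their roles.\<close>

lemma graph_in_thickening:
  assumes \<alpha>: "coarse_map X Y \<alpha>" and \<beta>: "coarse_map X Y \<beta>"
  shows "(\<lambda>x. (\<alpha> x, \<beta> x)) ` mspace X \<in> thickening_structure Y"
proof -
  have thick: "bounded_in Y (g ` (f -` B \<inter> mspace X))"
    if "coarse_map X Y f" "coarse_map X Y g" "bounded_in Y B" for f g B
    using that by (intro bounded_in_image[OF that(2)]) (simp add: coarse_map_def)
  have "((\<lambda>x. (\<alpha> x, \<beta> x)) ` mspace X) `` B = \<beta> ` (\<alpha> -` B \<inter> mspace X)"
    and "((\<lambda>x. (\<alpha> x, \<beta> x)) ` mspace X)\<inverse> `` B = \<alpha> ` (\<beta> -` B \<inter> mspace X)" for B
    by blast+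
  then show ?thesis
    using thick \<alpha> \<beta> by (auto simp: thickening_structure_def coarse_map_mspace)
qed

lemma bounded_in_of_coeq_bounded:
  assumes "coarse_map X Y \<alpha>" "coarse_map X Y \<beta>"
    and Q: "mspace Q = mspace Y" "entourages Q = coeq_coarse_structure X Y \<alpha> \<beta>"
    and B: "bounded_in Q B"
  shows "bounded_in Y B"
proof (cases "B = {}")
  case True
  then show ?thesis
    by (simp add: bounded_in_iff_entourage entourages_def)
next
  case False
  then obtain b where b: "b \<in> B" by blast
  have "B \<times> B \<in> entourages Q"
    using B by (simp add: bounded_in_iff_entourage)
  then have thick: "B \<times> B \<in> thickening_structure Y"
    unfolding Q(2)
    by (rule subsetD[OF coeq_coarse_structure_least[OF coarse_structure_thickening
            entourages_subset_thickening graph_in_thickening[OF assms(1,2)]]])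
  have "b \<in> mspace Y"
    using coarse_structure_Times[OF coarse_structure_thickening thick] b by blast
  then have "bounded_in Y {b}"
    by (simp add: Metric_space.mbounded_insert[OF Metric_space_mspace_mdist]
        Metric_space.mbounded_empty[OF Metric_space_mspace_mdist])
  with thick have "bounded_in Y ((B \<times> B) `` {b})"
    by (simp add: thickening_structure_def)
  \<comment> \<open>A bounded set is the thickening of any of its points by the entourage \<open>B \<times> B\<close>.\<close>
  moreover have "(B \<times> B) `` {b} = B" using b by blast
  ultimately show ?thesis by simp
qed


section \<open>The universal property\<close>

lemma coarse_map_id_coeq:
  assumes "coarse_map X Y \<alpha>" "coarse_map X Y \<beta>"
    and Q: "mspace Q = mspace Y" "entourages Q = coeq_coarse_structure X Y \<alpha> \<beta>"
  shows "coarse_map Y Q id"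
  unfolding coarse_map_def
proof (intro conjI ballI allI impI)
  show "id \<in> mspace Y \<rightarrow> mspace Q" using Q(1) by simp
  show "map_prod id id ` E \<in> entourages Q" if "E \<in> entourages Y" for E
    using that entourages_subset_coeq[OF assms(1,2)] Q(2) by (auto simp: map_prod.id)
  show "bounded_in Y (id -` B \<inter> mspace Y)" if "bounded_in Q B" for B
    using bounded_in_of_coeq_bounded[OF assms that]
    by (rule Metric_space.mbounded_subset[OF Metric_space_mspace_mdist]) auto
qed

lemma coarse_map_from_coeq:
  assumes \<alpha>: "coarse_map X Y \<alpha>" and \<beta>: "coarse_map X Y \<beta>"
    and Q: "mspace Q = mspace Y" "entourages Q = coeq_coarse_structure X Y \<alpha> \<beta>"
    and f: "coarse_map Y Z f" and close: "close_maps X Z (f \<circ> \<alpha>) (f \<circ> \<beta>)"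
  shows "coarse_map Q Z f"
  unfolding coarse_map_def
proof (intro conjI ballI allI impI)
  show "f \<in> mspace Q \<rightarrow> mspace Z"
    using f Q(1) by (simp add: coarse_map_def)
  show "bounded_in Q (f -` B \<inter> mspace Q)" if "bounded_in Z B" for B
  proof -
    have "bounded_in Y (f -` B \<inter> mspace Y)"
      using f that unfolding coarse_map_def by blast
    from bounded_in_image[OF coarse_map_id_coeq[OF \<alpha> \<beta> Q] this] show ?thesis
      using Q(1) by simp
  qed
  let ?\<E> = "{E. E \<subseteq> mspace Y \<times> mspace Y \<and> map_prod f f ` E \<in> entourages Z}"
  note cs = coarse_structure_entourages[of Z]
  have "coarse_structure (mspace Y) ?\<E>"
    unfolding coarse_structure_def
  proof (intro conjI ballI allI impI)
    show "?\<E> \<subseteq> Pow (mspace Y \<times> mspace Y)" by blast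
    have "map_prod f f ` Id_on (mspace Y) \<subseteq> Id_on (mspace Z)"
      using coarse_map_mspace[OF f] by (auto simp: Id_on_iff)
    then show "Id_on (mspace Y) \<in> ?\<E>"
      using coarse_structure_subset[OF cs coarse_structure_Id_on[OF cs]] by auto
    show "F \<in> ?\<E>" if "E \<in> ?\<E>" "F \<subseteq> E" for E F
      using that coarse_structure_subset[OF cs _ image_mono[OF that(2)]] by blast
    show "E \<union> F \<in> ?\<E>" if "E \<in> ?\<E>" "F \<in> ?\<E>" for E F
      using that coarse_structure_Un[OF cs] by (simp add: image_Un)
    show "E\<inverse> \<in> ?\<E>" if "E \<in> ?\<E>" for E
    proof -
      have "map_prod f f ` (E\<inverse>) = (map_prod f f ` E)\<inverse>" by force
      with that show ?thesis using coarse_structure_converse[OF cs] by auto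
    qed
    show "E O F \<in> ?\<E>" if EF: "E \<in> ?\<E>" "F \<in> ?\<E>" for E F
    proof -
      have "map_prod f f ` (E O F) \<subseteq> (map_prod f f ` E) O (map_prod f f ` F)" by force
      then have "map_prod f f ` (E O F) \<in> entourages Z"
        using EF coarse_structure_subset[OF cs coarse_structure_relcomp[OF cs]] by blast
      with EF show ?thesis by blast
    qed
  qed
  moreover have "entourages Y \<subseteq> ?\<E>"
    using f coarse_structure_Times[OF coarse_structure_entourages[of Y]]
    unfolding coarse_map_def by blast
  moreover have "(\<lambda>x. (\<alpha> x, \<beta> x)) ` mspace X \<in> ?\<E>"
  proof -
    have "map_prod f f ` (\<lambda>x. (\<alpha> x, \<beta> x)) ` mspace X \<in> entourages Z"
      using close by (simp add: close_maps_def image_image)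
    moreover have "(\<lambda>x. (\<alpha> x, \<beta> x)) ` mspace X \<subseteq> mspace Y \<times> mspace Y"
      using coarse_map_mspace[OF \<alpha>] coarse_map_mspace[OF \<beta>] by blast
    ultimately show ?thesis by blast
  qed
  ultimately have "coeq_coarse_structure X Y \<alpha> \<beta> \<subseteq> ?\<E>"
    by (rule coeq_coarse_structure_least)
  then show "map_prod f f ` E \<in> entourages Z" if "E \<in> entourages Q" for E
    using that Q(2) by blast
qed

lemma coarse_class_in_coarse_hom: "coarse_map X Y f \<Longrightarrow> coarse_class X Y f \<in> coarse_hom X Y"
  unfolding coarse_class_def coarse_hom_def by (rule quotientI) simp

lemma coarse_hom_cases:
  assumes "F \<in> coarse_hom X Y"
  obtains f where "coarse_map X Y f" "F = coarse_class X Y f"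
  using assms unfolding coarse_class_def coarse_hom_def by (auto elim: quotientE)

lemma coarse_class_eq_iff:
  assumes "coarse_map X Y f" "coarse_map X Y g"
  shows "coarse_class X Y f = coarse_class X Y g \<longleftrightarrow> close_maps X Y f g"
  unfolding coarse_class_def using assms
  by (subst eq_equiv_class_iff[OF equiv_closeness]) (auto simp: closeness_def)

theorem is_coarse_coequalizer_coeq:
  fixes X :: "'a metric" and Y :: "'b metric" and Q :: "'b metric"
  assumes \<alpha>: "coarse_map X Y \<alpha>" and \<beta>: "coarse_map X Y \<beta>"
    and Q: "mspace Q = mspace Y" "entourages Q = coeq_coarse_structure X Y \<alpha> \<beta>"
  shows "is_coarse_coequalizer TYPE('c) X Y (coarse_class X Y \<alpha>) (coarse_class X Y \<beta>)
    Q (coarse_class Y Q id)"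
  unfolding is_coarse_coequalizer_def
proof (intro conjI allI ballI impI)
  note id = coarse_map_id_coeq[OF \<alpha> \<beta> Q]
  show "coarse_class X Y \<alpha> \<in> coarse_hom X Y" "coarse_class X Y \<beta> \<in> coarse_hom X Y"
    "coarse_class Y Q id \<in> coarse_hom Y Q"
    using \<alpha> \<beta> id by (simp_all add: coarse_class_in_coarse_hom)
  have "close_maps X Q (id \<circ> \<alpha>) (id \<circ> \<beta>)"
    using graph_in_coeq Q(2) by (simp add: close_maps_def)
  then show "coarse_comp X Q (coarse_class Y Q id) (coarse_class X Y \<alpha>) =
      coarse_comp X Q (coarse_class Y Q id) (coarse_class X Y \<beta>)"
    unfolding coarse_comp_class[OF \<alpha> id] coarse_comp_class[OF \<beta> id]
      coarse_class_eq_iff[OF coarse_map_comp[OF \<alpha> id] coarse_map_comp[OF \<beta> id]] .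
  fix Z :: "'c metric" and F
  assume "F \<in> coarse_hom Y Z"
    and F: "coarse_comp X Z F (coarse_class X Y \<alpha>) = coarse_comp X Z F (coarse_class X Y \<beta>)"
  then obtain f where f: "coarse_map Y Z f" and Ff: "F = coarse_class Y Z f"
    by (elim coarse_hom_cases)
  have "close_maps X Z (f \<circ> \<alpha>) (f \<circ> \<beta>)"
    using F unfolding Ff coarse_comp_class[OF \<alpha> f] coarse_comp_class[OF \<beta> f]
      coarse_class_eq_iff[OF coarse_map_comp[OF \<alpha> f] coarse_map_comp[OF \<beta> f]] .
  then have fQ: "coarse_map Q Z f"
    by (rule coarse_map_from_coeq[OF \<alpha> \<beta> Q f])
  show "\<exists>!H. H \<in> coarse_hom Q Z \<and> coarse_comp Y Z H (coarse_class Y Q id) = F"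
  proof (intro ex1I conjI; (elim conjE)?)
    show "coarse_class Q Z f \<in> coarse_hom Q Z"
      by (rule coarse_class_in_coarse_hom[OF fQ])
    show "coarse_comp Y Z (coarse_class Q Z f) (coarse_class Y Q id) = F"
      by (simp add: coarse_comp_class[OF id fQ] Ff)
    fix H assume "H \<in> coarse_hom Q Z" and H: "coarse_comp Y Z H (coarse_class Y Q id) = F"
    then obtain h where h: "coarse_map Q Z h" and Hh: "H = coarse_class Q Z h"
      by (elim coarse_hom_cases)
    have hY: "coarse_map Y Z h"
      using coarse_map_comp[OF id h] by simp
    have "coarse_class Y Z h = coarse_class Y Z f"
      using H by (simp add: Hh Ff coarse_comp_class[OF id h])
    then have "close_maps Y Z h f"
      by (simp add: coarse_class_eq_iff[OF hY f])
    \<comment> \<open>Closeness refers to the source only through its points, which \<open>Y\<close> and \<open>Q\<close> share.\<close>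
    then have "close_maps Q Z h f"
      by (simp add: close_maps_def Q(1))
    then show "H = coarse_class Q Z f"
      by (simp add: Hh coarse_class_eq_iff[OF h fQ])
  qed
qed

theorem proposition34:
  fixes X :: "'a metric" and Y :: "'b metric" and \<alpha> \<beta> :: "'a \<Rightarrow> 'b"
  assumes "coarse_map X Y \<alpha>" and "coarse_map X Y \<beta>"
  shows "(\<exists>Q :: 'b metric. mspace Q = mspace Y \<and> entourages Q = coeq_coarse_structure X Y \<alpha> \<beta>) \<and>
    (\<forall>Q :: 'b metric. mspace Q = mspace Y \<and> entourages Q = coeq_coarse_structure X Y \<alpha> \<beta> \<longrightarrow>
       is_coarse_coequalizer TYPE('c) X Y (coarse_class X Y \<alpha>) (coarse_class X Y \<beta>)
         Q (coarse_class Y Q id))"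
  using coeq_metrizable[OF assms] is_coarse_coequalizer_coeq[OF assms] by blast

end
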